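(* There is an absolute constant $c$ such that every Boolean function $F$ of $n$ variables with factorized implicant width $\mathsf{fiw}(F)=k$ is computed by a canonical deterministic structured NNF with at most $c\,k\,n$ gates; namely, for a vtree $T$ attaining $\mathsf{fiw}(F,T)=k$, the circuit $C_{F,T}$ (uniquely determined by $F$ and $T$) is a deterministic NNF structured by $T$ computing $F$ of size $O(kn)$.
   Context: Boolean functions: $F\colon\{0,1\}^X\to\{0,1\}$, $\mathsf{sat}(F)=F^{-1}(1)$. For $Y$ a set of variables and $b\colon Y\cap X\to\{0,1\}$, the cofactor $F(b,X\setminus Y)$ is $b'\mapsto F(b\cup b')$ on $\{0,1\}^{X\setminus Y}$. A function $G$ on $\{0,1\}^{Y\cap X}$ is a factor of $F$ relative to $Y$ if for some cofactor $F'$ of $F$ induced by an assignment of $Y\cap X$, $G(b)=1$ iff $F(b,X\setminus Y)=F'$; $\mathsf{factors}(F,Y)$ is the set of factors. For disjoint $Y,Y'\subseteq X$ and $H\in\mathsf{factors}(F,Y\cup Y')$, $\mathsf{impl}(F,H,Y,Y')$ is the set of pairs $(G,G')\in\mathsf{factors}(F,Y)\times\mathsf{factors}(F,Y')$ with $\mathsf{sat}(G)\times\mathsf{sat}(G')\subseteq\mathsf{sat}(H)$ (where $B\times B'=\{b\cup b'\}$). Circuits: DAGs with input gates labelled by distinct variables or constants, internal unbounded-fanin $\wedge$, $\vee$ and fanin-1 $\neg$ gates, an output gate; size = number of gates; $C_g$ is the subcircuit at $g$, $\mathsf{var}(C_g)$ its variables. NNF: $\neg$ only applied to input gates. Deterministic: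 for every $\vee$-gate, any two distinct inputs $h,h'$ have $\mathsf{sat}(C_h)\cap\mathsf{sat}(C_{h'})=\emptyset$. A vtree for $Y$ is a rooted ordered binary tree with leaves in bijection with $Y$; $T_v$, $Y_v$ denote the subtree at $v$ and its leaves. A fanin-2 $\wedge$-gate with inputs $h,h'$ is structured by node $v$ with children $v_l,v_r$ if $\mathsf{var}(C_h)\subseteq Y_{v_l}$, $\mathsf{var}(C_{h'})\subseteq Y_{v_r}$; a circuit is structured by $T$ if every $\wedge$-gate has fanin 2 and is structured by some node of $T$; it is a structured NNF if it is an NNF structured by some vtree. A class of structured NNFs is canonical if any two circuits of the class computing the same function and structured by the same vtree are syntactically equal. Construction (for $T$ a vtree for $X$ whose non-leaf nodes have two children): for $v\in T$, $H\in\mathsf{factors}(F,X_v)$: if $v$ is a leaf $x$ and $F(0,X\setminus\{x\})=F(1,X\setminus\{x\})$, then $\mathsf{factors}(F,\{x\})=\{H\}$ and $C_{v,H}=\top$; otherwise $\mathsf{factors}(F,\{x\})=\{H_0,H_1\}$ with $\mathsf{sat}(H_c)=\{x\mapsto c\}$, $C_{v,H_0}=\neg x$, $C_{v,H_1}=x$. If $v$ has children $w,w'$: $C_{v,H}=\bigvee_{(G,G')\in\mathsf{impl}(F,H,X_w,X_{w'})}(C_{w,G}\wedge C_{w',G'})$ (subcircuits $C_{w,G}$ for the same pair $(w,G)$ are shared). Let $C_{F,T}=C_{r,F}$ with $r$ the root ($F$ is a factor of itself relative to $X$). The factorized implicant width is $\mathsf{fiw}(F,T)=\max_{v\in T}|\{g\in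 C_{F,T}: g \text{ an }\wedge\text{-gate structured by } v\}|$ and $\mathsf{fiw}(F)=\min_T\mathsf{fiw}(F,T)$ over vtrees $T$ for $X$.
   Formalization: If n=1 or F is constant 0, then k=0 and the bound ckn fails, so cn is proved there; n≥1 is assumed (no vtree otherwise); for F constant 0, C_{F,T} is set to ⊥; canonicity is for circuits paired with their vtree; variables are natural numbers. *)

theory Defs
  imports Main "HOL-Library.FuncSet"
begin

section \<open>Boolean functions, cofactors, factors, implicants\<close>

type_synonym 'x asg = "'x \<rightharpoonup> bool"
type_synonym 'x bfun = "'x asg \<Rightarrow> bool"

definition asgs :: "'x set \<Rightarrow> 'x asg set" where
  "asgs X = {b. dom b = X}"

text \<open>Boolean functions on \<open>{0,1}\<^sup>X\<close> are extensional, so that HOL equality of two of them is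
  equality as functions on \<open>{0,1}\<^sup>X\<close>.\<close>

definition bfuns :: "'x set \<Rightarrow> 'x bfun set" where
  "bfuns X = asgs X \<rightarrow>\<^sub>E UNIV"

definition sat :: "'x set \<Rightarrow> 'x bfun \<Rightarrow> 'x asg set" where
  "sat X F = {b \<in> asgs X. F b}"

definition cofactor :: "'x set \<Rightarrow> 'x bfun \<Rightarrow> 'x set \<Rightarrow> 'x asg \<Rightarrow> 'x bfun" where
  "cofactor X F Y b = (\<lambda>b' \<in> asgs (X - Y). F (b ++ b'))"

definition factors :: "'x set \<Rightarrow> 'x bfun \<Rightarrow> 'x set \<Rightarrow> 'x bfun set" where
  "factors X F Y =
     {G. \<exists>b\<^sub>0 \<in> asgs (Y \<inter> X).
           G = (\<lambda>b \<in> asgs (Y \<inter> X). cofactor X F Y b = cofactor X F Y b\<^sub>0)}"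

definition impl ::
  "'x set \<Rightarrow> 'x bfun \<Rightarrow> 'x bfun \<Rightarrow> 'x set \<Rightarrow> 'x set \<Rightarrow> ('x bfun \<times> 'x bfun) set" where
  "impl X F H Y Y' =
     {(G, G'). G \<in> factors X F Y \<and> G' \<in> factors X F Y' \<and>
        {b ++ b' | b b'. b \<in> sat Y G \<and> b' \<in> sat Y' G'} \<subseteq> sat (Y \<union> Y') H}"


section \<open>Vtrees\<close>

datatype 'x vtree = Leaf 'x | Node "'x vtree" "'x vtree"

fun leaf_list :: "'x vtree \<Rightarrow> 'x list" where
  "leaf_list (Leaf x) = [x]"
| "leaf_list (Node l r) = leaf_list l @ leaf_list r"

definition leaves :: "'x vtree \<Rightarrow> 'x set" where
  "leaves T = set (leaf_list T)"

definition vtree_for :: "'x set \<Rightarrow> 'x vtree \<Rightarrow> bool" where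
  "vtree_for Y T \<longleftrightarrow> distinct (leaf_list T) \<and> leaves T = Y"

text \<open>A node \<open>v\<close> of a vtree is represented by the subtree rooted at \<open>v\<close>; as the leaves are
  distinct, different nodes have different subtrees.\<close>

fun nodes :: "'x vtree \<Rightarrow> 'x vtree set" where
  "nodes (Leaf x) = {Leaf x}"
| "nodes (Node l r) = insert (Node l r) (nodes l \<union> nodes r)"


section \<open>Circuits\<close>

text \<open>The inputs of a conjunction are ordered, because structuring refers to a left and a right
  input, and may coincide, as in \<open>\<top> \<and> \<top>\<close> with a shared constant gate. The inputs of a
  disjunction form a set.\<close>

datatype ('g, 'x) label =
  Var 'x | Const bool | Neg 'g | And "'g list" | Or "'g set"

fun inputs :: "('g, 'x) label \<Rightarrow> 'g set" where
  "inputs (Var x) = {}"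
| "inputs (Const c) = {}"
| "inputs (Neg h) = {h}"
| "inputs (And hs) = set hs"
| "inputs (Or H) = H"

record ('g, 'x) circuit =
  label_of :: "'g \<rightharpoonup> ('g, 'x) label"
  out_gate :: 'g

definition gates :: "('g, 'x) circuit \<Rightarrow> 'g set" where
  "gates C = dom (label_of C)"

definition csize :: "('g, 'x) circuit \<Rightarrow> nat" where
  "csize C = card (gates C)"

definition wires :: "('g, 'x) circuit \<Rightarrow> ('g \<times> 'g) set" where
  "wires C = {(h, g). \<exists>l. label_of C g = Some l \<and> h \<in> inputs l}"

definition is_input :: "('g, 'x) circuit \<Rightarrow> 'g \<Rightarrow> bool" where
  "is_input C g \<longleftrightarrow> (\<exists>x. label_of C g = Some (Var x)) \<or> (\<exists>c. label_of C g = Some (Const c))"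

definition wf_circuit :: "('g, 'x) circuit \<Rightarrow> bool" where
  "wf_circuit C \<longleftrightarrow>
     finite (gates C) \<and> out_gate C \<in> gates C \<and>
     (\<forall>(h, g) \<in> wires C. h \<in> gates C) \<and> acyclic (wires C) \<and>
     inj_on (label_of C) {g. is_input C g}"

definition gvars :: "('g, 'x) circuit \<Rightarrow> 'g \<Rightarrow> 'x set" where
  "gvars C g = {x. \<exists>h. (h, g) \<in> (wires C)\<^sup>* \<and> label_of C h = Some (Var x)}"

definition cvars :: "('g, 'x) circuit \<Rightarrow> 'x set" where
  "cvars C = {x. \<exists>h. label_of C h = Some (Var x)}"

inductive evals :: "('g, 'x) circuit \<Rightarrow> 'x asg \<Rightarrow> 'g \<Rightarrow> bool \<Rightarrow> bool" for C b where
  "label_of C g = Some (Var x) \<Longrightarrow> b x = Some c \<Longrightarrow> evals C b g c"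
| "label_of C g = Some (Const c) \<Longrightarrow> evals C b g c"
| "label_of C g = Some (Neg h) \<Longrightarrow> evals C b h c \<Longrightarrow> evals C b g (\<not> c)"
| "label_of C g = Some (And hs) \<Longrightarrow> \<forall>h \<in> set hs. evals C b h True \<Longrightarrow> evals C b g True"
| "label_of C g = Some (And hs) \<Longrightarrow> h \<in> set hs \<Longrightarrow> evals C b h False \<Longrightarrow> evals C b g False"
| "label_of C g = Some (Or H) \<Longrightarrow> h \<in> H \<Longrightarrow> evals C b h True \<Longrightarrow> evals C b g True"
| "label_of C g = Some (Or H) \<Longrightarrow> \<forall>h \<in> H. evals C b h False \<Longrightarrow> evals C b g False"

text \<open>Satisfying assignments of the subcircuit at \<open>g\<close>, as a function of a variable set \<open>Y\<close>
  that contains the variables of the subcircuit.\<close>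

definition gate_sat :: "('g, 'x) circuit \<Rightarrow> 'x set \<Rightarrow> 'g \<Rightarrow> 'x asg set" where
  "gate_sat C Y g = {b \<in> asgs Y. evals C b g True}"

definition computes :: "('g, 'x) circuit \<Rightarrow> 'x set \<Rightarrow> 'x bfun \<Rightarrow> bool" where
  "computes C X F \<longleftrightarrow> cvars C \<subseteq> X \<and> gate_sat C X (out_gate C) = sat X F"

definition nnf :: "('g, 'x) circuit \<Rightarrow> bool" where
  "nnf C \<longleftrightarrow> wf_circuit C \<and> (\<forall>g h. label_of C g = Some (Neg h) \<longrightarrow> is_input C h)"

text \<open>Two inputs of a disjunction may mention different variables, so their satisfying
  assignments are compared over the variables of the whole circuit.\<close>

definition deterministic :: "('g, 'x) circuit \<Rightarrow> bool" where
  "deterministic C \<longleftrightarrow>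
     (\<forall>g H. label_of C g = Some (Or H) \<longrightarrow>
        (\<forall>h \<in> H. \<forall>h' \<in> H. h \<noteq> h' \<longrightarrow> gate_sat C (cvars C) h \<inter> gate_sat C (cvars C) h' = {}))"

definition structured_at :: "('g, 'x) circuit \<Rightarrow> 'x vtree \<Rightarrow> 'g \<Rightarrow> bool" where
  "structured_at C v g \<longleftrightarrow>
     (\<exists>l r h h'. v = Node l r \<and> label_of C g = Some (And [h, h']) \<and>
        gvars C h \<subseteq> leaves l \<and> gvars C h' \<subseteq> leaves r)"

definition structured_by :: "('g, 'x) circuit \<Rightarrow> 'x vtree \<Rightarrow> bool" where
  "structured_by C T \<longleftrightarrow>
     (\<forall>g hs. label_of C g = Some (And hs) \<longrightarrow> (\<exists>v \<in> nodes T. structured_at C v g))"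

text \<open>The members of a class of structured NNFs carry the vtree they are structured by: the same
  circuit may be structured by several vtrees (any non-leaf vtree structures \<open>\<top> \<and> \<top>\<close>).\<close>

definition canonical :: "(('g, 'x) circuit \<times> 'x vtree) set \<Rightarrow> bool" where
  "canonical K \<longleftrightarrow>
     (\<forall>(C, T) \<in> K. vtree_for (leaves T) T \<and> nnf C \<and> cvars C \<subseteq> leaves T \<and> structured_by C T) \<and>
     (\<forall>(C, T) \<in> K. \<forall>(C', T') \<in> K.
        T = T' \<and> gate_sat C (leaves T) (out_gate C) = gate_sat C' (leaves T) (out_gate C') \<longrightarrow>
        C = C')"


section \<open>The circuit of a function and a vtree, and factorized implicant width\<close>

text \<open>\<open>OrG w w' H\<close> is the output gate of \<open>C\<^bsub>v,H\<^esub>\<close> for the node \<open>v = Node w w'\<close>, and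
  \<open>AndG w w' H G G'\<close> is its disjunct for the pair \<open>(G, G')\<close>.\<close>

datatype 'x fgate =
    VarG 'x | ConstG bool | NegG 'x
  | OrG "'x vtree" "'x vtree" "'x bfun"
  | AndG "'x vtree" "'x vtree" "'x bfun" "'x bfun" "'x bfun"

fun node_gate :: "'x set \<Rightarrow> 'x bfun \<Rightarrow> 'x vtree \<Rightarrow> 'x bfun \<Rightarrow> 'x fgate" where
  "node_gate X F (Leaf x) H =
     (if cofactor X F {x} [x \<mapsto> False] = cofactor X F {x} [x \<mapsto> True] then ConstG True
      else if sat {x} H = {[x \<mapsto> False]} then NegG x
      else VarG x)"
| "node_gate X F (Node w w') H = OrG w w' H"

fun fgate_label :: "'x set \<Rightarrow> 'x bfun \<Rightarrow> 'x fgate \<Rightarrow> ('x fgate, 'x) label" where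
  "fgate_label X F (VarG x) = Var x"
| "fgate_label X F (ConstG c) = Const c"
| "fgate_label X F (NegG x) = Neg (VarG x)"
| "fgate_label X F (OrG w w' H) =
     Or {AndG w w' H G G' | G G'. (G, G') \<in> impl X F H (leaves w) (leaves w')}"
| "fgate_label X F (AndG w w' H G G') = And [node_gate X F w G, node_gate X F w' G']"

text \<open>\<open>F\<close> is a factor of itself relative to \<open>X\<close> only if it is satisfiable (a factor is satisfied
  by the assignment inducing it). The circuit of the constant \<open>0\<close> is \<open>\<bottom>\<close>, in accordance with
  the disjunction over \<open>impl\<close> being empty in this case.\<close>

definition root_gate :: "'x set \<Rightarrow> 'x bfun \<Rightarrow> 'x vtree \<Rightarrow> 'x fgate" where
  "root_gate X F T = (if sat X F = {} then ConstG False else node_gate X F T F)"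

definition fcircuit :: "'x set \<Rightarrow> 'x bfun \<Rightarrow> 'x vtree \<Rightarrow> ('x fgate, 'x) circuit" where
  "fcircuit X F T =
     \<lparr>label_of = (\<lambda>g. if (g, root_gate X F T) \<in> {(h, g'). h \<in> inputs (fgate_label X F g')}\<^sup>*
                      then Some (fgate_label X F g) else None),
      out_gate = root_gate X F T\<rparr>"

definition fclass :: "(('x fgate, 'x) circuit \<times> 'x vtree) set" where
  "fclass = {(fcircuit X F T, T) | X F T. F \<in> bfuns X \<and> vtree_for X T}"

definition fiw_vtree :: "'x set \<Rightarrow> 'x bfun \<Rightarrow> 'x vtree \<Rightarrow> nat" where
  "fiw_vtree X F T =
     Max ((\<lambda>v. card {g \<in> gates (fcircuit X F T). structured_at (fcircuit X F T) v g}) ` nodes T)"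

definition fiw :: "'x set \<Rightarrow> 'x bfun \<Rightarrow> nat" where
  "fiw X F = (INF T \<in> {T. vtree_for X T}. fiw_vtree X F T)"

end

theory Submission imports Defs begin

text \<open>
  Two assignments of \<open>Y\<close> are equivalent if they induce the same cofactor of \<open>F\<close>; the factors
  relative to \<open>Y\<close> are the indicator functions of the equivalence classes, so they partition
  \<open>{0,1}\<^sup>Y\<close>. For disjoint \<open>Y\<close> and \<open>Y'\<close> the product of a class on \<open>Y\<close> and a class on \<open>Y'\<close> lies in
  a single class on \<open>Y \<union> Y'\<close>, hence every factor relative to \<open>Y \<union> Y'\<close> is the disjoint union of
  the products listed by its implicants. This gives correctness and determinism of the circuit by
  induction on the vtree. For the size, each node \<open>v\<close> of the vtree owns at most \<open>k\<close> conjunctions,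
  and each disjunction of \<open>v\<close> has at least one of them as an input; there are \<open>n - 1\<close> inner
  nodes and at most \<open>2n + 2\<close> literals and constants.
\<close>

section \<open>Factors\<close>

lemma finite_asgs: "finite X \<Longrightarrow> finite (asgs X)"
  using finite_set_of_finite_maps[of X "UNIV :: bool set"] by (simp add: asgs_def)

lemma asgs_restrict: "b \<in> asgs X \<Longrightarrow> Y \<subseteq> X \<Longrightarrow> b |` Y \<in> asgs Y"
  by (auto simp: asgs_def)

lemma asgs_add: "b \<in> asgs Y \<Longrightarrow> b' \<in> asgs Y' \<Longrightarrow> b ++ b' \<in> asgs (Y \<union> Y')"
  by (auto simp: asgs_def)

lemma asgs_singleton: "asgs {x} = {[x \<mapsto> False], [x \<mapsto> True]}"
proof
  show "asgs {x} \<subseteq> {[x \<mapsto> False], [x \<mapsto> True]}"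
  proof
    fix b assume "b \<in> asgs {x}"
    then obtain c where "b = [x \<mapsto> c]"
      by (auto simp: asgs_def dom_eq_singleton_conv)
    then show "b \<in> {[x \<mapsto> False], [x \<mapsto> True]}"
      by (cases c) auto
  qed
qed (auto simp: asgs_def)

lemma map_add_restrict_restrict:
  assumes "b \<in> asgs (Y \<union> Y')"
  shows "b |` Y ++ b |` Y' = b"
proof
  fix x show "(b |` Y ++ b |` Y') x = b x"
    using assms by (cases "b x") (auto simp: asgs_def map_add_def restrict_map_def dom_def split: option.splits)
qed

lemma bfuns_eqI:
  assumes "F \<in> bfuns X" "F' \<in> bfuns X" "sat X F = sat X F'"
  shows "F = F'"
proof (rule PiE_ext)
  show "F \<in> asgs X \<rightarrow>\<^sub>E UNIV" "F' \<in> asgs X \<rightarrow>\<^sub>E UNIV"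
    using assms by (simp_all add: bfuns_def)
  show "F b = F' b" if "b \<in> asgs X" for b
    using assms(3) that by (auto simp: sat_def)
qed

lemma cofactor_eq_iff:
  "cofactor X F Y a = cofactor X F Y b \<longleftrightarrow> (\<forall>c \<in> asgs (X - Y). F (a ++ c) = F (b ++ c))"
proof
  assume eq: "cofactor X F Y a = cofactor X F Y b"
  show "\<forall>c \<in> asgs (X - Y). F (a ++ c) = F (b ++ c)"
  proof
    fix c assume "c \<in> asgs (X - Y)"
    then show "F (a ++ c) = F (b ++ c)"
      using fun_cong[OF eq, of c] by (simp add: cofactor_def)
  qed
next
  assume "\<forall>c \<in> asgs (X - Y). F (a ++ c) = F (b ++ c)"
  then show "cofactor X F Y a = cofactor X F Y b"
    unfolding cofactor_def by (intro restrict_ext) blast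
qed

lemma cofactor_add_eqI:
  assumes disj: "Y \<inter> Y' = {}" and sub: "Y \<subseteq> X" "Y' \<subseteq> X"
    and a: "a \<in> asgs Y" "a' \<in> asgs Y'" and b: "b \<in> asgs Y" "b' \<in> asgs Y'"
    and eq: "cofactor X F Y a = cofactor X F Y b"
    and eq': "cofactor X F Y' a' = cofactor X F Y' b'"
  shows "cofactor X F (Y \<union> Y') (a ++ a') = cofactor X F (Y \<union> Y') (b ++ b')"
  unfolding cofactor_eq_iff
proof
  fix c assume c: "c \<in> asgs (X - (Y \<union> Y'))"
  have comm: "d ++ (d' ++ c) = d' ++ (d ++ c)" if "d \<in> asgs Y" "d' \<in> asgs Y'" for d d'
  proof -
    have "d ++ d' = d' ++ d"
      using that disj by (intro map_add_comm) (auto simp: asgs_def)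
    then show ?thesis
      by (metis map_add_assoc)
  qed
  have "a' ++ c \<in> asgs (X - Y)"
    using a c disj sub by (auto simp: asgs_def)
  then have "F (a ++ (a' ++ c)) = F (b ++ (a' ++ c))"
    using eq unfolding cofactor_eq_iff by blast
  also have "\<dots> = F (a' ++ (b ++ c))"
    using comm[OF b(1) a(2)] by simp
  also have "b ++ c \<in> asgs (X - Y')"
    using b c disj sub by (auto simp: asgs_def)
  then have "F (a' ++ (b ++ c)) = F (b' ++ (b ++ c))"
    using eq' unfolding cofactor_eq_iff by blast
  also have "\<dots> = F (b ++ (b' ++ c))"
    using comm[OF b] by simp
  finally show "F (a ++ a' ++ c) = F (b ++ b' ++ c)"
    by simp
qed

lemma finite_factors:
  assumes "finite X"
  shows "finite (factors X F Y)"
proof -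
  have "factors X F Y =
      (\<lambda>b\<^sub>0. \<lambda>b \<in> asgs (Y \<inter> X). cofactor X F Y b = cofactor X F Y b\<^sub>0) ` asgs (Y \<inter> X)"
    by (auto simp: factors_def)
  then show ?thesis
    using assms by (simp add: finite_asgs)
qed

lemma sat_factor_iff:
  assumes "Y \<subseteq> X" "G \<in> factors X F Y" "a \<in> sat Y G"
  shows "b \<in> sat Y G \<longleftrightarrow> b \<in> asgs Y \<and> cofactor X F Y b = cofactor X F Y a"
  using assms by (auto simp: factors_def sat_def Int_absorb2)

lemma sat_factor_nonempty:
  assumes "Y \<subseteq> X" "G \<in> factors X F Y"
  shows "sat Y G \<noteq> {}"
  using assms by (auto simp: factors_def sat_def Int_absorb2)

lemma factor_of_asg_exists:
  assumes "Y \<subseteq> X" "b \<in> asgs Y"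
  obtains G where "G \<in> factors X F Y" "b \<in> sat Y G"
proof
  let ?G = "\<lambda>a \<in> asgs Y. cofactor X F Y a = cofactor X F Y b"
  show "?G \<in> factors X F Y" "b \<in> sat Y ?G"
    using assms by (auto simp: factors_def sat_def Int_absorb2)
qed

lemma factors_eqI:
  assumes "Y \<subseteq> X" "G \<in> factors X F Y" "G' \<in> factors X F Y" "b \<in> sat Y G" "b \<in> sat Y G'"
  shows "G = G'"
proof (rule bfuns_eqI)
  show "G \<in> bfuns Y" "G' \<in> bfuns Y"
    using assms(1-3) by (auto simp: factors_def bfuns_def Int_absorb2)
  show "sat Y G = sat Y G'"
    using sat_factor_iff[OF assms(1,2,4)] sat_factor_iff[OF assms(1,3,5)] by blast
qed

lemma self_in_factors:
  assumes F: "F \<in> bfuns X" and sat: "sat X F \<noteq> {}"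
  shows "F \<in> factors X F X"
proof -
  obtain a where a: "a \<in> asgs X" "F a"
    using sat by (auto simp: sat_def)
  have "asgs {} = {Map.empty :: 'a asg}"
    by (auto simp: asgs_def)
  then have eq: "cofactor X F X b = cofactor X F X a \<longleftrightarrow> F b" for b
    using a by (simp add: cofactor_eq_iff)
  have "F = (\<lambda>b \<in> asgs X. cofactor X F X b = cofactor X F X a)"
    using F by (simp add: eq bfuns_def PiE_def extensional_restrict)
  then show ?thesis
    using a by (auto simp: factors_def)
qed

lemma sat_iff_ex_impl:
  assumes disj: "Y \<inter> Y' = {}" and sub: "Y \<subseteq> X" "Y' \<subseteq> X"
    and H: "H \<in> factors X F (Y \<union> Y')" and b: "b \<in> asgs (Y \<union> Y')"
  shows "b \<in> sat (Y \<union> Y') H \<longleftrightarrow>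
    (\<exists>(G, G') \<in> impl X F H Y Y'. b |` Y \<in> sat Y G \<and> b |` Y' \<in> sat Y' G')"
proof
  have sub_Un: "Y \<union> Y' \<subseteq> X"
    using sub by simp
  have split: "b |` Y ++ b |` Y' = b"
    using b by (rule map_add_restrict_restrict)
  assume bH: "b \<in> sat (Y \<union> Y') H"
  have bY: "b |` Y \<in> asgs Y" and bY': "b |` Y' \<in> asgs Y'"
    using b by (auto intro: asgs_restrict)
  obtain G where G: "G \<in> factors X F Y" "b |` Y \<in> sat Y G"
    using factor_of_asg_exists[OF sub(1) bY] by blast
  obtain G' where G': "G' \<in> factors X F Y'" "b |` Y' \<in> sat Y' G'"
    using factor_of_asg_exists[OF sub(2) bY'] by blast
  have "a ++ a' \<in> sat (Y \<union> Y') H" if "a \<in> sat Y G" "a' \<in> sat Y' G'" for a a'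
  proof -
    have a: "a \<in> asgs Y" "cofactor X F Y a = cofactor X F Y (b |` Y)"
      using that(1) sat_factor_iff[OF sub(1) G] by auto
    have a': "a' \<in> asgs Y'" "cofactor X F Y' a' = cofactor X F Y' (b |` Y')"
      using that(2) sat_factor_iff[OF sub(2) G'] by auto
    have "cofactor X F (Y \<union> Y') (a ++ a') = cofactor X F (Y \<union> Y') b"
      using cofactor_add_eqI[OF disj sub a(1) a'(1) bY bY' a(2) a'(2)] split by simp
    then show ?thesis
      using sat_factor_iff[OF sub_Un H bH] asgs_add a a' by blast
  qed
  then have "(G, G') \<in> impl X F H Y Y'"
    using G G' by (auto simp: impl_def)
  then show "\<exists>(G, G') \<in> impl X F H Y Y'. b |` Y \<in> sat Y G \<and> b |` Y' \<in> sat Y' G'"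
    using G G' by blast
next
  assume "\<exists>(G, G') \<in> impl X F H Y Y'. b |` Y \<in> sat Y G \<and> b |` Y' \<in> sat Y' G'"
  then have "b |` Y ++ b |` Y' \<in> sat (Y \<union> Y') H"
    unfolding impl_def by blast
  then show "b \<in> sat (Y \<union> Y') H"
    using map_add_restrict_restrict[OF b] by simp
qed

lemma impl_nonempty:
  assumes "Y \<inter> Y' = {}" "Y \<subseteq> X" "Y' \<subseteq> X" "H \<in> factors X F (Y \<union> Y')"
  shows "impl X F H Y Y' \<noteq> {}"
proof -
  obtain b where "b \<in> sat (Y \<union> Y') H"
    using sat_factor_nonempty[OF _ assms(4)] assms(2,3) by blast
  moreover from this have "b \<in> asgs (Y \<union> Y')"
    by (simp add: sat_def)
  ultimately show ?thesis
    using sat_iff_ex_impl[OF assms] by auto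
qed


section \<open>Vtrees\<close>

lemma leaves_simps [simp]:
  "leaves (Leaf x) = {x}"
  "leaves (Node l r) = leaves l \<union> leaves r"
  by (auto simp: leaves_def)

lemma finite_leaves [simp]: "finite (leaves T)"
  by (simp add: leaves_def)

lemma leaves_nonempty: "leaves T \<noteq> {}"
  by (induction T) auto

lemma self_in_nodes [simp]: "T \<in> nodes T"
  by (cases T) auto

lemma finite_nodes [simp]: "finite (nodes T)"
  by (induction T) auto

lemma leaves_subset_of_node: "v \<in> nodes T \<Longrightarrow> leaves v \<subseteq> leaves T"
  by (induction T) auto

lemma nodes_trans: "v \<in> nodes T \<Longrightarrow> u \<in> nodes v \<Longrightarrow> u \<in> nodes T"
  by (induction T) auto

lemma children_in_nodes: "Node w w' \<in> nodes T \<Longrightarrow> w \<in> nodes T \<and> w' \<in> nodes T"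
  using nodes_trans[of "Node w w'" T] by simp

lemma distinct_node: "distinct (leaf_list T) \<Longrightarrow> v \<in> nodes T \<Longrightarrow> distinct (leaf_list v)"
  by (induction T) auto

lemma leaves_children_disjoint:
  assumes "distinct (leaf_list T)" "Node w w' \<in> nodes T"
  shows "leaves w \<inter> leaves w' = {}"
  using distinct_node[OF assms] by (simp add: leaves_def)

definition inner_nodes :: "'x vtree \<Rightarrow> 'x vtree set" where
  "inner_nodes T = {v \<in> nodes T. \<exists>l r. v = Node l r}"

lemma finite_inner_nodes [simp]: "finite (inner_nodes T)"
  by (simp add: inner_nodes_def)

lemma card_inner_nodes_less: "card (inner_nodes T) < length (leaf_list T)"
proof (induction T)
  case (Leaf x)
  then show ?case
    by (simp add: inner_nodes_def)
next
  case (Node l r)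
  have "inner_nodes (Node l r) = insert (Node l r) (inner_nodes l \<union> inner_nodes r)"
    by (auto simp: inner_nodes_def)
  then have "card (inner_nodes (Node l r)) \<le> Suc (card (inner_nodes l \<union> inner_nodes r))"
    by (simp add: card_insert_if)
  then show ?case
    using Node card_Un_le[of "inner_nodes l" "inner_nodes r"] by simp
qed

lemma ex_vtree_for:
  assumes "finite X" "X \<noteq> {}"
  shows "\<exists>T. vtree_for X T"
  using assms
proof (induction X rule: finite_ne_induct)
  case (singleton x)
  have "vtree_for {x} (Leaf x)"
    by (simp add: vtree_for_def)
  then show ?case ..
next
  case (insert x X)
  then obtain T where "vtree_for X T"
    by blast
  then have "vtree_for (insert x X) (Node (Leaf x) T)"
    using insert by (auto simp: vtree_for_def leaves_def)
  then show ?case ..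
qed


section \<open>Evaluation of gates\<close>

lemma evals_Var: "label_of C g = Some (Var x) \<Longrightarrow> evals C b g c \<longleftrightarrow> b x = Some c"
  by (auto elim: evals.cases intro: evals.intros)

lemma evals_Const: "label_of C g = Some (Const c') \<Longrightarrow> evals C b g c \<longleftrightarrow> c = c'"
  by (auto elim: evals.cases intro: evals.intros)

lemma evals_Neg: "label_of C g = Some (Neg h) \<Longrightarrow> evals C b g c \<longleftrightarrow> evals C b h (\<not> c)"
  using evals.intros(3)[of C g h b "\<not> c"] by (auto elim: evals.cases)

lemma evals_And_True:
  "label_of C g = Some (And hs) \<Longrightarrow> evals C b g True \<longleftrightarrow> (\<forall>h \<in> set hs. evals C b h True)"
  by (auto elim: evals.cases intro: evals.intros)

lemma evals_Or_True:
  assumes "label_of C g = Some (Or H)"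
  shows "evals C b g True \<longleftrightarrow> (\<exists>h \<in> H. evals C b h True)"
proof
  assume "evals C b g True"
  then show "\<exists>h \<in> H. evals C b h True"
    by cases (use assms in auto)
qed (use assms in \<open>auto intro: evals.intros\<close>)

lemma evals_mono:
  assumes "evals C b g c" "b \<subseteq>\<^sub>m b'"
  shows "evals C b' g c"
  using assms
proof (induction rule: evals.induct)
  case (1 g x c)
  then have "b' x = Some c"
    by (metis domI map_le_def)
  then show ?case
    using 1 by (auto intro: evals.intros)
qed (auto intro: evals.intros)

lemma disjoint_gate_sat_mono:
  assumes "Y \<subseteq> X" "gate_sat C X g \<inter> gate_sat C X h = {}"
  shows "gate_sat C Y g \<inter> gate_sat C Y h = {}"
proof (rule ccontr)
  assume "gate_sat C Y g \<inter> gate_sat C Y h \<noteq> {}"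
  then obtain b where b: "b \<in> asgs Y" "evals C b g True" "evals C b h True"
    by (auto simp: gate_sat_def)
  define b' where "b' = (\<lambda>x. if x \<in> X then Some False else None) ++ b"
  have le: "b \<subseteq>\<^sub>m b'"
    by (simp add: b'_def)
  have "b' \<in> asgs X"
    using b assms(1) by (auto simp: b'_def asgs_def dom_def map_add_def split: option.splits)
  then have "b' \<in> gate_sat C X g \<inter> gate_sat C X h"
    using b evals_mono[OF _ le] by (auto simp: gate_sat_def)
  then show False
    using assms(2) by simp
qed


section \<open>The circuit of a function and a vtree\<close>

fun gate_rank :: "'x fgate \<Rightarrow> nat" where
  "gate_rank (VarG x) = 0"
| "gate_rank (ConstG c) = 0"
| "gate_rank (NegG x) = 1"
| "gate_rank (OrG w w' H) = 2 * (size w + size w') + 3"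
| "gate_rank (AndG w w' H G G') = 2 * (size w + size w') + 2"

lemma gate_rank_node_gate: "gate_rank (node_gate X F v H) \<le> 2 * size v + 1"
  by (cases v) auto

lemma gate_rank_less: "h \<in> inputs (fgate_label X F g) \<Longrightarrow> gate_rank h < gate_rank g"
  using gate_rank_node_gate[of X F]
  by (cases g) (fastforce simp: less_Suc_eq_le add_mult_distrib2 intro: le_trans trans_le_add1 trans_le_add2)+

fun gate_leaves :: "'x fgate \<Rightarrow> 'x set" where
  "gate_leaves (VarG x) = {x}"
| "gate_leaves (ConstG c) = {}"
| "gate_leaves (NegG x) = {x}"
| "gate_leaves (OrG w w' H) = leaves w \<union> leaves w'"
| "gate_leaves (AndG w w' H G G') = leaves w \<union> leaves w'"

lemma gate_leaves_node_gate: "gate_leaves (node_gate X F v H) \<subseteq> leaves v"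
  by (cases v) auto

lemma gate_leaves_mono: "h \<in> inputs (fgate_label X F g) \<Longrightarrow> gate_leaves h \<subseteq> gate_leaves g"
  using gate_leaves_node_gate[of X F] by (cases g) fastforce+

fun fgate_inv :: "'x set \<Rightarrow> 'x bfun \<Rightarrow> 'x vtree \<Rightarrow> 'x fgate \<Rightarrow> bool" where
  "fgate_inv X F T (VarG x) \<longleftrightarrow> x \<in> X"
| "fgate_inv X F T (ConstG c) \<longleftrightarrow> True"
| "fgate_inv X F T (NegG x) \<longleftrightarrow> x \<in> X"
| "fgate_inv X F T (OrG w w' H) \<longleftrightarrow>
     Node w w' \<in> nodes T \<and> H \<in> factors X F (leaves w \<union> leaves w')"
| "fgate_inv X F T (AndG w w' H G G') \<longleftrightarrow>
     Node w w' \<in> nodes T \<and> H \<in> factors X F (leaves w \<union> leaves w') \<and>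
     (G, G') \<in> impl X F H (leaves w) (leaves w')"

lemma fgate_label_eq_iff:
  "fgate_label X F g = Var x \<longleftrightarrow> g = VarG x"
  "fgate_label X F g = Const c \<longleftrightarrow> g = ConstG c"
  "fgate_label X F g = Neg h \<longleftrightarrow> (\<exists>x. g = NegG x \<and> h = VarG x)"
  "fgate_label X F g = And hs \<longleftrightarrow>
     (\<exists>w w' H G G'. g = AndG w w' H G G' \<and> hs = [node_gate X F w G, node_gate X F w' G'])"
  "fgate_label X F g = Or hs' \<longleftrightarrow>
     (\<exists>w w' H. g = OrG w w' H \<and>
       hs' = {AndG w w' H G G' | G G'. (G, G') \<in> impl X F H (leaves w) (leaves w')})"
  by (cases g; auto)+

locale vtree_function =
  fixes X :: "'x set" and F :: "'x bfun" and T :: "'x vtree"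
  assumes F_bfun: "F \<in> bfuns X" and T_vtree: "vtree_for X T"
begin

abbreviation C where "C \<equiv> fcircuit X F T"

lemma leaves_T: "leaves T = X"
  using T_vtree by (simp add: vtree_for_def)

lemma finite_X: "finite X"
  using finite_leaves[of T] leaves_T by simp

lemma length_leaf_list: "length (leaf_list T) = card X"
  using T_vtree by (metis distinct_card leaves_def vtree_for_def)

lemma leaves_node_subset: "v \<in> nodes T \<Longrightarrow> leaves v \<subseteq> X"
  using leaves_subset_of_node leaves_T by blast

lemma Node_in_nodesD:
  assumes "Node w w' \<in> nodes T"
  shows "leaves w \<inter> leaves w' = {}" "leaves w \<subseteq> X" "leaves w' \<subseteq> X" "w \<in> nodes T" "w' \<in> nodes T"
  using assms T_vtree leaves_children_disjoint children_in_nodes leaves_node_subset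
  by (fastforce simp: vtree_for_def)+

lemma gates_eq:
  "gates C = {g. (g, root_gate X F T) \<in> {(h, g'). h \<in> inputs (fgate_label X F g')}\<^sup>*}"
  by (auto simp: gates_def fcircuit_def dom_def)

lemma label_of_eq_Some_iff: "label_of C g = Some l \<longleftrightarrow> g \<in> gates C \<and> fgate_label X F g = l"
  unfolding gates_eq by (auto simp: fcircuit_def)

lemma out_gate_eq: "out_gate C = root_gate X F T"
  by (simp add: fcircuit_def)

lemma root_in_gates: "root_gate X F T \<in> gates C"
  by (simp add: gates_eq)

lemma input_in_gates: "g \<in> gates C \<Longrightarrow> h \<in> inputs (fgate_label X F g) \<Longrightarrow> h \<in> gates C"
  by (auto simp: gates_eq intro: converse_rtrancl_into_rtrancl)

lemma wires_iff: "(h, g) \<in> wires C \<longleftrightarrow> g \<in> gates C \<and> h \<in> inputs (fgate_label X F g)"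
  by (auto simp: wires_def label_of_eq_Some_iff)

lemma fgate_inv_node_gate:
  assumes "v \<in> nodes T" "H \<in> factors X F (leaves v)"
  shows "fgate_inv X F T (node_gate X F v H)"
  using assms leaves_node_subset[OF assms(1)] by (cases v) auto

lemma fgate_inv_input:
  assumes "fgate_inv X F T g" "h \<in> inputs (fgate_label X F g)"
  shows "fgate_inv X F T h"
proof (cases g)
  case (AndG w w' H G G')
  then have "w \<in> nodes T" "w' \<in> nodes T" "G \<in> factors X F (leaves w)" "G' \<in> factors X F (leaves w')"
    using assms(1) children_in_nodes by (auto simp: impl_def)
  then show ?thesis
    using AndG assms(2) fgate_inv_node_gate by auto
qed (use assms in auto)

lemma fgate_inv_gates:
  assumes "g \<in> gates C"
  shows "fgate_inv X F T g"
proof -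
  have root: "fgate_inv X F T (root_gate X F T)"
    using self_in_factors[OF F_bfun] fgate_inv_node_gate[OF self_in_nodes]
    by (simp add: root_gate_def leaves_T)
  have "(g, root_gate X F T) \<in> {(h, g'). h \<in> inputs (fgate_label X F g')}\<^sup>*"
    using assms by (simp add: gates_eq)
  then show ?thesis
    by (induction rule: converse_rtrancl_induct) (use root fgate_inv_input in auto)
qed

lemma gates_subset:
  "gates C \<subseteq> VarG ` X \<union> NegG ` X \<union> {ConstG False, ConstG True}
     \<union> {g \<in> gates C. \<exists>w w' H. g = OrG w w' H}
     \<union> {g \<in> gates C. \<exists>w w' H G G'. g = AndG w w' H G G'}"
proof
  fix g assume g: "g \<in> gates C"
  then show "g \<in> VarG ` X \<union> NegG ` X \<union> {ConstG False, ConstG True}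
     \<union> {g \<in> gates C. \<exists>w w' H. g = OrG w w' H}
     \<union> {g \<in> gates C. \<exists>w w' H G G'. g = AndG w w' H G G'}"
    using fgate_inv_gates[OF g] by (cases g) auto
qed

lemma finite_gates: "finite (gates C)"
proof -
  define A where "A = (\<Union>v \<in> nodes T. factors X F (leaves v))"
  define Ors where "Ors = (\<Union>v \<in> nodes T. \<Union>H \<in> A. case v of Node w w' \<Rightarrow> {OrG w w' H} | Leaf x \<Rightarrow> {})"
  define Ands where "Ands = (\<Union>v \<in> nodes T. \<Union>H \<in> A. \<Union>G \<in> A. \<Union>G' \<in> A.
    case v of Node w w' \<Rightarrow> {AndG w w' H G G'} | Leaf x \<Rightarrow> {})"
  have "finite A"
    by (simp add: A_def finite_factors finite_X)
  then have fin: "finite Ors" "finite Ands"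
    by (auto simp: Ors_def Ands_def split: vtree.splits)
  have AI: "H \<in> A" if "v \<in> nodes T" "H \<in> factors X F (leaves v)" for v H
    using that by (auto simp: A_def)
  have "g \<in> VarG ` X \<union> NegG ` X \<union> {ConstG False, ConstG True} \<union> Ors \<union> Ands"
    if g: "g \<in> gates C" for g
  proof (cases g)
    case (OrG w w' H)
    then have v: "Node w w' \<in> nodes T" and "H \<in> A"
      using fgate_inv_gates[OF g] AI[of "Node w w'"] by simp_all
    then have "g \<in> Ors"
      unfolding Ors_def OrG by (intro UN_I[OF v] UN_I[of H]) simp_all
    then show ?thesis
      by simp
  next
    case (AndG w w' H G G')
    then have v: "Node w w' \<in> nodes T" and "H \<in> factors X F (leaves (Node w w'))"
      "G \<in> factors X F (leaves w)" "G' \<in> factors X F (leaves w')"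
      using fgate_inv_gates[OF g] by (simp_all add: impl_def)
    then have "H \<in> A" "G \<in> A" "G' \<in> A"
      using AI children_in_nodes[OF v] by blast+
    then have "g \<in> Ands"
      unfolding Ands_def AndG by (intro UN_I[OF v] UN_I[of H] UN_I[of G] UN_I[of G']) simp_all
    then show ?thesis
      by simp
  qed (use fgate_inv_gates[OF g] in auto)
  then have "gates C \<subseteq> VarG ` X \<union> NegG ` X \<union> {ConstG False, ConstG True} \<union> Ors \<union> Ands"
    by blast
  then show ?thesis
    by (rule finite_subset) (simp add: finite_X fin)
qed

lemma wf_circuit: "wf_circuit C"
proof -
  have "wires C \<subseteq> measure gate_rank"
    using gate_rank_less by (auto simp: wires_iff)
  then have "acyclic (wires C)"
    by (meson wf_acyclic wf_measure wf_subset)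
  moreover have "inj_on (label_of C) {g. is_input C g}"
  proof (rule inj_onI, clarify)
    fix g h assume "is_input C g" "is_input C h" and eq: "label_of C g = label_of C h"
    then show "g = h"
      by (metis is_input_def label_of_eq_Some_iff fgate_label_eq_iff(1,2))
  qed
  moreover have "\<forall>(h, g) \<in> wires C. h \<in> gates C"
    by (auto simp: wires_iff intro: input_in_gates)
  ultimately show ?thesis
    using finite_gates root_in_gates by (simp add: wf_circuit_def out_gate_eq)
qed

lemma nnf: "nnf C"
  using wf_circuit input_in_gates
  by (fastforce simp: nnf_def is_input_def label_of_eq_Some_iff fgate_label_eq_iff)

lemma cvars_subset: "cvars C \<subseteq> X"
  using fgate_inv_gates by (fastforce simp: cvars_def label_of_eq_Some_iff fgate_label_eq_iff)

lemma gvars_subset: "gvars C g \<subseteq> gate_leaves g"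
proof -
  have "gate_leaves h \<subseteq> gate_leaves g" if "(h, g) \<in> (wires C)\<^sup>*" for h
    using that
    by (induction rule: converse_rtrancl_induct) (use gate_leaves_mono wires_iff in blast)+
  then show ?thesis
    by (fastforce simp: gvars_def label_of_eq_Some_iff fgate_label_eq_iff)
qed

lemma structured_at_AndG:
  assumes "AndG w w' H G G' \<in> gates C"
  shows "structured_at C (Node w w') (AndG w w' H G G')"
proof -
  have "gvars C (node_gate X F v K) \<subseteq> leaves v" for v K
    using gvars_subset gate_leaves_node_gate by (rule subset_trans)
  then show ?thesis
    using assms by (simp add: structured_at_def label_of_eq_Some_iff)
qed

lemma structured_by: "structured_by C T"
  unfolding structured_by_def
proof (intro allI impI)
  fix g hs assume "label_of C g = Some (And hs)"
  then obtain w w' H G G' where g: "g = AndG w w' H G G'" "g \<in> gates C"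
    by (auto simp: label_of_eq_Some_iff fgate_label_eq_iff)
  then have "Node w w' \<in> nodes T"
    using fgate_inv_gates by fastforce
  then show "\<exists>v \<in> nodes T. structured_at C v g"
    using g structured_at_AndG by blast
qed

lemma evals_leaf_gate:
  assumes x: "x \<in> X" and H: "H \<in> factors X F {x}" and b: "b \<in> asgs X"
    and g: "node_gate X F (Leaf x) H \<in> gates C"
  shows "evals C b (node_gate X F (Leaf x) H) True \<longleftrightarrow> b |` {x} \<in> sat {x} H"
proof -
  have sub: "{x} \<subseteq> X"
    using x by simp
  obtain c where c: "b x = Some c"
    using b x by (auto simp: asgs_def)
  have bx: "b |` {x} = [x \<mapsto> c]"
    using c by (auto simp: restrict_map_def)
  obtain a where a: "a \<in> sat {x} H"
    using sat_factor_nonempty[OF sub H] by blast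
  then have a_cases: "a = [x \<mapsto> False] \<or> a = [x \<mapsto> True]"
    by (auto simp: sat_def asgs_singleton)
  have sat: "d \<in> sat {x} H \<longleftrightarrow> d \<in> asgs {x} \<and> cofactor X F {x} d = cofactor X F {x} a" for d
    by (rule sat_factor_iff[OF sub H a])
  have upd_neq: "[x \<mapsto> False] \<noteq> [x \<mapsto> True]"
    by (metis fun_upd_same option.inject)
  have satH: "sat {x} H = {d \<in> {[x \<mapsto> False], [x \<mapsto> True]}. cofactor X F {x} d = cofactor X F {x} a}"
    using sat by (simp add: set_eq_iff asgs_singleton)
  have pair: "{d \<in> {p, q}. f d = f d\<^sub>0} = (if f p = f q then {p, q} else {d\<^sub>0})"
    if "d\<^sub>0 = p \<or> d\<^sub>0 = q" for p q d\<^sub>0 :: "'x asg" and f :: "'x asg \<Rightarrow> 'x bfun"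
    using that by auto
  have singleton: "sat {x} H = {a}"
    if "cofactor X F {x} [x \<mapsto> False] \<noteq> cofactor X F {x} [x \<mapsto> True]"
    unfolding satH pair[OF a_cases] using that by simp
  consider (const) "cofactor X F {x} [x \<mapsto> False] = cofactor X F {x} [x \<mapsto> True]"
    | (neg) "cofactor X F {x} [x \<mapsto> False] \<noteq> cofactor X F {x} [x \<mapsto> True]"
        "sat {x} H = {[x \<mapsto> False]}"
    | (pos) "cofactor X F {x} [x \<mapsto> False] \<noteq> cofactor X F {x} [x \<mapsto> True]"
        "sat {x} H = {[x \<mapsto> True]}"
    using a_cases singleton by blast
  then show ?thesis
  proof cases
    case const
    then have "sat {x} H = asgs {x}"
      unfolding satH pair[OF a_cases] asgs_singleton by simp
    moreover have "evals C b (ConstG True) True"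
      using const g by (subst evals_Const[of _ _ True]) (auto simp: label_of_eq_Some_iff)
    ultimately show ?thesis
      using const bx by (auto simp: asgs_def)
  next
    case neg
    then have "NegG x \<in> gates C"
      using g by simp
    moreover from this have "VarG x \<in> gates C"
      using input_in_gates by fastforce
    ultimately have "evals C b (NegG x) True \<longleftrightarrow> b x = Some False"
      by (simp add: evals_Neg evals_Var label_of_eq_Some_iff)
    then show ?thesis
      using neg c bx by (auto simp: fun_eq_iff)
  next
    case pos
    have eq: "node_gate X F (Leaf x) H = VarG x"
      using pos upd_neq by simp
    then have "evals C b (VarG x) True \<longleftrightarrow> b x = Some True"
      using g by (simp add: evals_Var label_of_eq_Some_iff)
    then show ?thesis
      using pos eq c bx by (auto simp: fun_eq_iff)
  qed
qed

lemma evals_node_gate: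
  assumes "v \<in> nodes T" "H \<in> factors X F (leaves v)" "b \<in> asgs X" "node_gate X F v H \<in> gates C"
  shows "evals C b (node_gate X F v H) True \<longleftrightarrow> b |` leaves v \<in> sat (leaves v) H"
  using assms
proof (induction v arbitrary: H)
  case (Leaf x)
  then show ?case
    using evals_leaf_gate leaves_node_subset[of "Leaf x"] by simp
next
  case (Node w w')
  note w = Node_in_nodesD[OF Node.prems(1)]
  have H: "H \<in> factors X F (leaves w \<union> leaves w')" and or: "OrG w w' H \<in> gates C"
    using Node.prems by simp_all
  have and_iff: "evals C b (AndG w w' H G G') True \<longleftrightarrow>
      b |` leaves w \<in> sat (leaves w) G \<and> b |` leaves w' \<in> sat (leaves w') G'"
    if impl: "(G, G') \<in> impl X F H (leaves w) (leaves w')" for G G'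
  proof -
    have gate: "AndG w w' H G G' \<in> gates C"
      using input_in_gates[OF or] impl by simp
    then have "node_gate X F w G \<in> gates C" "node_gate X F w' G' \<in> gates C"
      using input_in_gates[OF gate] by simp_all
    moreover have "G \<in> factors X F (leaves w)" "G' \<in> factors X F (leaves w')"
      using impl by (auto simp: impl_def)
    moreover have "label_of C (AndG w w' H G G') =
        Some (And [node_gate X F w G, node_gate X F w' G'])"
      using gate by (simp add: label_of_eq_Some_iff)
    ultimately show ?thesis
      using Node.IH w Node.prems(3) by (simp add: evals_And_True)
  qed
  have "label_of C (OrG w w' H) =
      Some (Or {AndG w w' H G G' | G G'. (G, G') \<in> impl X F H (leaves w) (leaves w')})"
    using or by (simp add: label_of_eq_Some_iff)
  then have "evals C b (OrG w w' H) True \<longleftrightarrow>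
      (\<exists>(G, G') \<in> impl X F H (leaves w) (leaves w'). evals C b (AndG w w' H G G') True)"
    by (auto simp: evals_Or_True)
  also have "\<dots> \<longleftrightarrow> (\<exists>(G, G') \<in> impl X F H (leaves w) (leaves w').
      b |` leaves w \<in> sat (leaves w) G \<and> b |` leaves w' \<in> sat (leaves w') G')"
    using and_iff by auto
  also have "\<dots> \<longleftrightarrow> b |` (leaves w \<union> leaves w') \<in> sat (leaves w \<union> leaves w') H"
    using sat_iff_ex_impl[OF w(1-3) H, of "b |` (leaves w \<union> leaves w')"]
      asgs_restrict[OF Node.prems(3), of "leaves w \<union> leaves w'"] w(2,3)
    by (simp add: Int_absorb1 Int_absorb2)
  finally show ?case
    by simp
qed

lemma gate_sat_out_gate: "gate_sat C X (out_gate C) = sat X F"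
proof (cases "sat X F = {}")
  case True
  then have "root_gate X F T = ConstG False"
    by (simp add: root_gate_def)
  then have "label_of C (out_gate C) = Some (Const False)"
    unfolding out_gate_eq label_of_eq_Some_iff using root_in_gates by simp
  from evals_Const[OF this] have "gate_sat C X (out_gate C) = {}"
    by (simp add: gate_sat_def)
  then show ?thesis
    using True by simp
next
  case False
  then have root: "out_gate C = node_gate X F T F" "node_gate X F T F \<in> gates C"
    using root_in_gates by (simp_all add: out_gate_eq root_gate_def)
  have "F \<in> factors X F (leaves T)"
    using self_in_factors[OF F_bfun False] by (simp add: leaves_T)
  then have "evals C b (out_gate C) True \<longleftrightarrow> b |` X \<in> sat X F" if "b \<in> asgs X" for b
    using evals_node_gate[OF self_in_nodes _ that] root by (simp add: leaves_T)
  moreover have "b |` X = b" if "b \<in> asgs X" for b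
    using map_add_restrict_restrict[of b X "{}"] that by simp
  ultimately have "evals C b (out_gate C) True \<longleftrightarrow> b \<in> sat X F" if "b \<in> asgs X" for b
    using that by simp
  then show ?thesis
    by (auto simp: gate_sat_def sat_def)
qed

lemma computes: "computes C X F"
  using cvars_subset gate_sat_out_gate by (simp add: computes_def)

lemma gate_sat_AndG:
  assumes gate: "AndG w w' H G G' \<in> gates C" and b: "b \<in> gate_sat C X (AndG w w' H G G')"
  shows "b |` leaves w \<in> sat (leaves w) G" "b |` leaves w' \<in> sat (leaves w') G'"
proof -
  have inv: "Node w w' \<in> nodes T" "G \<in> factors X F (leaves w)" "G' \<in> factors X F (leaves w')"
    using fgate_inv_gates[OF gate] by (auto simp: impl_def)
  note w = Node_in_nodesD[OF inv(1)]
  have inputs: "node_gate X F w G \<in> gates C" "node_gate X F w' G' \<in> gates C"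
    using input_in_gates[OF gate] by simp_all
  have "label_of C (AndG w w' H G G') = Some (And [node_gate X F w G, node_gate X F w' G'])"
    using gate by (simp add: label_of_eq_Some_iff)
  then have "b \<in> asgs X" "evals C b (node_gate X F w G) True" "evals C b (node_gate X F w' G') True"
    using b by (simp_all add: gate_sat_def evals_And_True)
  then show "b |` leaves w \<in> sat (leaves w) G" "b |` leaves w' \<in> sat (leaves w') G'"
    using evals_node_gate inv w inputs by blast+
qed

lemma deterministic: "deterministic C"
  unfolding deterministic_def
proof (intro allI impI ballI)
  fix g hs h h'
  assume g: "label_of C g = Some (Or hs)" and h: "h \<in> hs" "h' \<in> hs" "h \<noteq> h'"
  then obtain w w' H where "g = OrG w w' H" and gate: "g \<in> gates C"
    and hs: "hs = {AndG w w' H G G' | G G'. (G, G') \<in> impl X F H (leaves w) (leaves w')}"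
    by (auto simp: label_of_eq_Some_iff fgate_label_eq_iff)
  then have "Node w w' \<in> nodes T"
    using fgate_inv_gates[OF gate] by simp
  then have w: "leaves w \<subseteq> X" "leaves w' \<subseteq> X"
    by (rule Node_in_nodesD)+
  have in_gates: "h \<in> gates C" "h' \<in> gates C"
    using g h input_in_gates by (auto simp: label_of_eq_Some_iff)
  obtain G G' where hG: "h = AndG w w' H G G'"
    and G: "G \<in> factors X F (leaves w)" "G' \<in> factors X F (leaves w')"
    using h(1) hs by (auto simp: impl_def)
  obtain K K' where hK: "h' = AndG w w' H K K'"
    and K: "K \<in> factors X F (leaves w)" "K' \<in> factors X F (leaves w')"
    using h(2) hs by (auto simp: impl_def)
  have "gate_sat C X h \<inter> gate_sat C X h' = {}"
  proof (rule ccontr)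
    assume "gate_sat C X h \<inter> gate_sat C X h' \<noteq> {}"
    then obtain b where "b \<in> gate_sat C X h" "b \<in> gate_sat C X h'"
      by blast
    then have "b |` leaves w \<in> sat (leaves w) G" "b |` leaves w' \<in> sat (leaves w') G'"
      "b |` leaves w \<in> sat (leaves w) K" "b |` leaves w' \<in> sat (leaves w') K'"
      using gate_sat_AndG[OF in_gates(1)[unfolded hG]] gate_sat_AndG[OF in_gates(2)[unfolded hK]]
      by (simp_all add: hG hK)
    then have "G = K" "G' = K'"
      using factors_eqI[OF w(1)] factors_eqI[OF w(2)] G K by blast+
    then show False
      using h(3) hG hK by simp
  qed
  then show "gate_sat C (cvars C) h \<inter> gate_sat C (cvars C) h' = {}"
    by (rule disjoint_gate_sat_mono[OF cvars_subset])
qed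

abbreviation and_gates where
  "and_gates \<equiv> {g \<in> gates C. \<exists>w w' H G G'. g = AndG w w' H G G'}"

abbreviation or_gates where
  "or_gates \<equiv> {g \<in> gates C. \<exists>w w' H. g = OrG w w' H}"

lemma card_structured_at_le:
  "v \<in> nodes T \<Longrightarrow> card {g \<in> gates C. structured_at C v g} \<le> fiw_vtree X F T"
  unfolding fiw_vtree_def by (rule Max_ge) auto

lemma card_and_gates_le: "card and_gates \<le> (card X - 1) * fiw_vtree X F T"
proof -
  have sub: "and_gates \<subseteq> (\<Union>v \<in> inner_nodes T. {g \<in> gates C. structured_at C v g})"
  proof clarify
    fix w w' H G G' assume g: "AndG w w' H G G' \<in> gates C"
    then have "Node w w' \<in> inner_nodes T"
      using fgate_inv_gates[OF g] by (simp add: inner_nodes_def)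
    then show "AndG w w' H G G' \<in> (\<Union>v \<in> inner_nodes T. {g \<in> gates C. structured_at C v g})"
      using g structured_at_AndG by blast
  qed
  have "card and_gates \<le> card (\<Union>v \<in> inner_nodes T. {g \<in> gates C. structured_at C v g})"
    by (rule card_mono[OF _ sub]) (simp add: finite_gates)
  also have "\<dots> \<le> (\<Sum>v \<in> inner_nodes T. card {g \<in> gates C. structured_at C v g})"
    by (rule card_UN_le) simp
  also have "\<dots> \<le> card (inner_nodes T) * fiw_vtree X F T"
    using sum_bounded_above[of "inner_nodes T" _ "fiw_vtree X F T"] card_structured_at_le
    by (simp add: inner_nodes_def)
  also have "\<dots> \<le> (card X - 1) * fiw_vtree X F T"
    using card_inner_nodes_less[of T] length_leaf_list by (intro mult_right_mono) auto
  finally show ?thesis .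
qed

lemma or_gate_has_input:
  assumes "OrG w w' H \<in> gates C"
  obtains G G' where "AndG w w' H G G' \<in> gates C"
proof -
  have "impl X F H (leaves w) (leaves w') \<noteq> {}"
    using fgate_inv_gates[OF assms] by (intro impl_nonempty) (auto dest: Node_in_nodesD)
  then obtain G G' where "(G, G') \<in> impl X F H (leaves w) (leaves w')"
    by auto
  then have "AndG w w' H G G' \<in> gates C"
    using input_in_gates[OF assms] by simp
  then show thesis
    by (rule that)
qed

lemma card_or_gates_le: "card or_gates \<le> card and_gates"
proof (rule surj_card_le)
  let ?f = "\<lambda>g. case g of AndG w w' H G G' \<Rightarrow> OrG w w' H | _ \<Rightarrow> g"
  show "finite and_gates"
    using finite_gates by simp
  show "or_gates \<subseteq> ?f ` and_gates"
  proof clarify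
    fix w w' H assume "OrG w w' H \<in> gates C"
    then obtain G G' where "AndG w w' H G G' \<in> gates C"
      by (rule or_gate_has_input)
    then show "OrG w w' H \<in> ?f ` and_gates"
      by (intro image_eqI[of _ _ "AndG w w' H G G'"]) auto
  qed
qed

lemma csize_le: "csize C \<le> 2 * card X + 2 + 2 * ((card X - 1) * fiw_vtree X F T)"
proof -
  have "csize C \<le> card (VarG ` X \<union> NegG ` X \<union> {ConstG False, ConstG True} \<union> or_gates \<union> and_gates)"
    unfolding csize_def by (rule card_mono[OF _ gates_subset]) (simp add: finite_X finite_gates)
  also have "\<dots> \<le> card (VarG ` X) + card (NegG ` X) + card {ConstG False :: 'x fgate, ConstG True}
      + card or_gates + card and_gates"
    by (intro order_trans[OF card_Un_le] add_right_mono order_refl)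
  also have "\<dots> \<le> card X + card X + 2 + card or_gates + card and_gates"
    using card_image_le[OF finite_X, of VarG] card_image_le[OF finite_X, of NegG] by simp
  finally show ?thesis
    using card_or_gates_le card_and_gates_le by linarith
qed

lemma csize_unsat:
  assumes "sat X F = {}"
  shows "csize C = 1"
proof -
  have "g = ConstG False"
    if "(g, ConstG False) \<in> {(h, g'). h \<in> inputs (fgate_label X F g')}\<^sup>*" for g
    using that by (induction rule: converse_rtrancl_induct) auto
  then have "gates C = {ConstG False}"
    using assms by (auto simp: gates_eq root_gate_def)
  then show ?thesis
    by (simp add: csize_def)
qed

lemma fiw_vtree_pos:
  assumes "card X \<ge> 2" "sat X F \<noteq> {}"
  shows "fiw_vtree X F T \<ge> 1"
proof -
  obtain w w' where T: "T = Node w w'"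
    using assms(1) leaves_T by (cases T) auto
  then have "OrG w w' F \<in> gates C"
    using root_in_gates assms(2) by (simp add: root_gate_def)
  then obtain G G' where "AndG w w' F G G' \<in> gates C"
    by (rule or_gate_has_input)
  then have "AndG w w' F G G' \<in> {g \<in> gates C. structured_at C T g}"
    using structured_at_AndG T by simp
  then have "card {g \<in> gates C. structured_at C T g} \<noteq> 0"
    using finite_gates by auto
  then show ?thesis
    using card_structured_at_le[OF self_in_nodes] by linarith
qed

lemma csize_bound:
  "if card X \<ge> 2 \<and> sat X F \<noteq> {} then csize C \<le> 6 * fiw_vtree X F T * card X
   else csize C \<le> 6 * card X"
proof -
  let ?n = "card X" and ?k = "fiw_vtree X F T"
  have n: "?n \<ge> 1"
    using leaves_nonempty[of T] finite_X leaves_T by (simp add: Suc_le_eq card_gt_0_iff)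
  have le: "csize C \<le> 2 * ?n + 2 + 2 * ((?n - 1) * ?k)"
    by (rule csize_le)
  consider "sat X F = {}" | "?n = 1" | "?n \<ge> 2" "sat X F \<noteq> {}"
    using n by linarith
  then show ?thesis
  proof cases
    case 1
    then show ?thesis
      using csize_unsat n by simp
  next
    case 2
    then show ?thesis
      using le by simp
  next
    case 3
    have "?n \<le> ?k * ?n"
      using fiw_vtree_pos[OF 3] by simp
    moreover have "(?n - 1) * ?k \<le> ?k * ?n"
      by (simp add: mult.commute)
    ultimately have "csize C \<le> 6 * (?k * ?n)"
      using le n by linarith
    then show ?thesis
      using 3 by (simp add: mult.assoc)
  qed
qed

end

lemma fclass_canonical: "canonical fclass"
proof -
  have "vtree_for (leaves T) T \<and> nnf C \<and> cvars C \<subseteq> leaves T \<and> structured_by C T"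
    if CT: "(C, T) \<in> fclass" for C T
  proof -
    obtain X F where C: "C = fcircuit X F T" and "F \<in> bfuns X" "vtree_for X T"
      using CT unfolding fclass_def by blast
    then interpret vtree_function X F T
      by unfold_locales
    show ?thesis
      using C nnf cvars_subset structured_by T_vtree leaves_T by simp
  qed
  moreover have "C = C'"
    if CT: "(C, T) \<in> fclass" "(C', T) \<in> fclass"
      and eq: "gate_sat C (leaves T) (out_gate C) = gate_sat C' (leaves T) (out_gate C')" for C C' T
  proof -
    obtain X F where C: "C = fcircuit X F T" and "F \<in> bfuns X" "vtree_for X T"
      using CT unfolding fclass_def by blast
    then interpret A: vtree_function X F T
      by unfold_locales
    obtain X' F' where C': "C' = fcircuit X' F' T" and "F' \<in> bfuns X'" "vtree_for X' T"
      using CT unfolding fclass_def by blast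
    then interpret B: vtree_function X' F' T
      by unfold_locales
    have X: "X' = X"
      using A.leaves_T B.leaves_T by simp
    have "sat X F = sat X F'"
      using eq A.gate_sat_out_gate B.gate_sat_out_gate A.leaves_T by (simp add: C C' X)
    then have "F = F'"
      using bfuns_eqI A.F_bfun B.F_bfun X by blast
    then show ?thesis
      by (simp add: C C' X)
  qed
  ultimately show ?thesis
    unfolding canonical_def by fast
qed

lemma fiw_attained:
  assumes "finite X" "X \<noteq> {}"
  shows "\<exists>T. vtree_for X T \<and> fiw_vtree X F T = fiw X F"
proof -
  have "fiw_vtree X F ` {T. vtree_for X T} \<noteq> {}"
    using ex_vtree_for[OF assms] by simp
  then have "fiw X F \<in> fiw_vtree X F ` {T. vtree_for X T}"
    unfolding fiw_def by (rule Inf_nat_def1)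
  then show ?thesis
    by force
qed

theorem theorem3:
  "canonical (fclass :: ((nat fgate, nat) circuit \<times> nat vtree) set) \<and>
   (\<exists>c::nat. \<forall>(X :: nat set) (F :: nat bfun) (n::nat) (k::nat).
      finite X \<and> X \<noteq> {} \<and> card X = n \<and> F \<in> bfuns X \<and> fiw X F = k \<longrightarrow>
      (\<exists>T. vtree_for X T \<and> fiw_vtree X F T = k) \<and>
      (\<forall>T. vtree_for X T \<and> fiw_vtree X F T = k \<longrightarrow>
         (fcircuit X F T, T) \<in> fclass \<and>
         nnf (fcircuit X F T) \<and>
         deterministic (fcircuit X F T) \<and>
         structured_by (fcircuit X F T) T \<and>
         computes (fcircuit X F T) X F \<and>
         (if n \<ge> 2 \<and> sat X F \<noteq> {} then csize (fcircuit X F T) \<le> c * k * n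
          else csize (fcircuit X F T) \<le> c * n)))"
proof (intro conjI exI[of _ 6] allI impI)
  show "canonical (fclass :: ((nat fgate, nat) circuit \<times> nat vtree) set)"
    by (rule fclass_canonical)
next
  fix X :: "nat set" and F :: "nat bfun" and n k
  assume "finite X \<and> X \<noteq> {} \<and> card X = n \<and> F \<in> bfuns X \<and> fiw X F = k"
  then show "\<exists>T. vtree_for X T \<and> fiw_vtree X F T = k"
    using fiw_attained by blast
next
  fix X :: "nat set" and F :: "nat bfun" and n k T
  assume asm: "finite X \<and> X \<noteq> {} \<and> card X = n \<and> F \<in> bfuns X \<and> fiw X F = k"
    "vtree_for X T \<and> fiw_vtree X F T = k"
  then interpret vtree_function X F T
    by unfold_locales auto
  show "(fcircuit X F T, T) \<in> fclass"
    using F_bfun T_vtree by (auto simp: fclass_def)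
  show "nnf C" "deterministic C" "structured_by C T" "computes C X F"
    by (rule nnf deterministic structured_by computes)+
  show "if n \<ge> 2 \<and> sat X F \<noteq> {} then csize C \<le> 6 * k * n else csize C \<le> 6 * n"
    using csize_bound asm by (metis (full_types))
qed

end
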